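(* Let $M_1, M_2, N$ be monoids and let $\iota_1:N\to M_1$, $\iota_2:N\to M_2$ be injective morphisms of monoids such that $\iota_1(N)$ and $\iota_2(N)$ are special submonoids of $M_1$ and $M_2$, respectively. Then the canonical morphisms $j_1: M_1 \to M_1*_NM_2$ and $j_2: M_2\to M_1*_NM_2$ are injective, and the submonoids $j_1(M_1)$, $j_2(M_2)$ and $(j_1\circ\iota_1)(N)$ are special in $M_1*_NM_2$. Moreover, $j_1(M_1)\cap j_2(M_2) = (j_1\circ\iota_1)(N) = (j_2\circ\iota_2)(N)$.
   Context: A submonoid $N$ of a monoid $M$ is special if it is closed under factors: $ab\in N$ implies $a,b\in N$ for all $a,b\in M$. The amalgamated product $M_1*_NM_2$ is the quotient of the free semigroup of nonempty finite sequences $(g_1,\dots,g_n)$ with entries in the disjoint union of $M_1$ and $M_2$ (with concatenation) by the congruence generated by: $(g_1,\dots,g_n)\equiv(g_1,\dots,g_{i-1},\tilde g_i,g_{i+2},\dots,g_n)$ if, with $g_i\in M_{\varepsilon}$ and $g_{i+1}\in M_{\eta}$, either $\varepsilon=\eta$ and $\tilde g_i=g_ig_{i+1}$; or $\varepsilon\ne\eta$, $g_{i+1}\in\iota_\eta(N)$ and $\tilde g_i=g_i\,(\iota_\varepsilon\circ\iota_\eta^{-1})(g_{i+1})$; or $\varepsilon\neq\eta$, $g_i\in\iota_\varepsilon(N)$ and $\tilde g_i=(\iota_\eta\circ\iota_\varepsilon^{-1})(g_i)\,g_{i+1}$. (This is the pushout of $\iota_1,\iota_2$ in the category of monoids.)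 The canonical morphism $j_i$ sends $g\in M_i$ to the class of the one-term sequence $(g)$. *)

theory Defs
  imports "HOL-Algebra.Group"
begin

definition special_submonoid :: "'a set \<Rightarrow> ('a, 'x) monoid_scheme \<Rightarrow> bool" where
  "special_submonoid N M \<longleftrightarrow> submonoid N M \<and>
    (\<forall>a \<in> carrier M. \<forall>b \<in> carrier M. a \<otimes>\<^bsub>M\<^esub> b \<in> N \<longrightarrow> a \<in> N \<and> b \<in> N)"

(* The library's hom asks only for compatibility with the multiplication. *)
definition monoid_hom ::
  "('a, 'x) monoid_scheme \<Rightarrow> ('b, 'y) monoid_scheme \<Rightarrow> ('a \<Rightarrow> 'b) set" where
  "monoid_hom M M' = {h \<in> hom M M'. h \<one>\<^bsub>M\<^esub> = \<one>\<^bsub>M'\<^esub>}"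

definition amalg_words ::
  "('a, 'x) monoid_scheme \<Rightarrow> ('b, 'y) monoid_scheme \<Rightarrow> ('a + 'b) list set" where
  "amalg_words M1 M2 = lists (carrier M1 <+> carrier M2) - {[]}"

(* amalg_red M1 M2 N i1 i2 x y z: the adjacent entries x, y may be replaced by the single
   entry z. The partially defined map i1 o i2^(-1) is expressed by naming the element n of N
   with i2 n equal to the given entry. *)
inductive amalg_red ::
  "('a, 'x) monoid_scheme \<Rightarrow> ('b, 'y) monoid_scheme \<Rightarrow> ('c, 'z) monoid_scheme \<Rightarrow>
   ('c \<Rightarrow> 'a) \<Rightarrow> ('c \<Rightarrow> 'b) \<Rightarrow> 'a + 'b \<Rightarrow> 'a + 'b \<Rightarrow> 'a + 'b \<Rightarrow> bool"
  for M1 M2 N i1 i2 where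
  same1: "a \<in> carrier M1 \<Longrightarrow> a' \<in> carrier M1 \<Longrightarrow>
    amalg_red M1 M2 N i1 i2 (Inl a) (Inl a') (Inl (a \<otimes>\<^bsub>M1\<^esub> a'))"
| same2: "b \<in> carrier M2 \<Longrightarrow> b' \<in> carrier M2 \<Longrightarrow>
    amalg_red M1 M2 N i1 i2 (Inr b) (Inr b') (Inr (b \<otimes>\<^bsub>M2\<^esub> b'))"
| right1: "a \<in> carrier M1 \<Longrightarrow> n \<in> carrier N \<Longrightarrow>
    amalg_red M1 M2 N i1 i2 (Inl a) (Inr (i2 n)) (Inl (a \<otimes>\<^bsub>M1\<^esub> i1 n))"
| right2: "b \<in> carrier M2 \<Longrightarrow> n \<in> carrier N \<Longrightarrow>
    amalg_red M1 M2 N i1 i2 (Inr b) (Inl (i1 n)) (Inr (b \<otimes>\<^bsub>M2\<^esub> i2 n))"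
| left1: "n \<in> carrier N \<Longrightarrow> b \<in> carrier M2 \<Longrightarrow>
    amalg_red M1 M2 N i1 i2 (Inl (i1 n)) (Inr b) (Inr (i2 n \<otimes>\<^bsub>M2\<^esub> b))"
| left2: "n \<in> carrier N \<Longrightarrow> a \<in> carrier M1 \<Longrightarrow>
    amalg_red M1 M2 N i1 i2 (Inr (i2 n)) (Inl a) (Inl (i1 n \<otimes>\<^bsub>M1\<^esub> a))"

inductive_set amalg_cong ::
  "('a, 'x) monoid_scheme \<Rightarrow> ('b, 'y) monoid_scheme \<Rightarrow> ('c, 'z) monoid_scheme \<Rightarrow>
   ('c \<Rightarrow> 'a) \<Rightarrow> ('c \<Rightarrow> 'b) \<Rightarrow> (('a + 'b) list \<times> ('a + 'b) list) set"
  for M1 M2 N i1 i2 where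
  red: "u \<in> lists (carrier M1 <+> carrier M2) \<Longrightarrow> v \<in> lists (carrier M1 <+> carrier M2) \<Longrightarrow>
    amalg_red M1 M2 N i1 i2 x y z \<Longrightarrow> (u @ [x, y] @ v, u @ [z] @ v) \<in> amalg_cong M1 M2 N i1 i2"
| refl: "w \<in> amalg_words M1 M2 \<Longrightarrow> (w, w) \<in> amalg_cong M1 M2 N i1 i2"
| sym: "(w, w') \<in> amalg_cong M1 M2 N i1 i2 \<Longrightarrow> (w', w) \<in> amalg_cong M1 M2 N i1 i2"
| trans: "(w, w') \<in> amalg_cong M1 M2 N i1 i2 \<Longrightarrow> (w', w'') \<in> amalg_cong M1 M2 N i1 i2 \<Longrightarrow>
    (w, w'') \<in> amalg_cong M1 M2 N i1 i2"
| append: "(u, u') \<in> amalg_cong M1 M2 N i1 i2 \<Longrightarrow> (v, v') \<in> amalg_cong M1 M2 N i1 i2 \<Longrightarrow>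
    (u @ v, u' @ v') \<in> amalg_cong M1 M2 N i1 i2"

definition amalg_class ::
  "('a, 'x) monoid_scheme \<Rightarrow> ('b, 'y) monoid_scheme \<Rightarrow> ('c, 'z) monoid_scheme \<Rightarrow>
   ('c \<Rightarrow> 'a) \<Rightarrow> ('c \<Rightarrow> 'b) \<Rightarrow> ('a + 'b) list \<Rightarrow> ('a + 'b) list set" where
  "amalg_class M1 M2 N i1 i2 w = amalg_cong M1 M2 N i1 i2 `` {w}"

(* The unit is the class of the one-term sequence consisting of the unit of M1; it is also
   the class of the unit of M2, see amalg_one_eq below. *)
definition amalg ::
  "('a, 'x) monoid_scheme \<Rightarrow> ('b, 'y) monoid_scheme \<Rightarrow> ('c, 'z) monoid_scheme \<Rightarrow>
   ('c \<Rightarrow> 'a) \<Rightarrow> ('c \<Rightarrow> 'b) \<Rightarrow> ('a + 'b) list set monoid" where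
  "amalg M1 M2 N i1 i2 =
    \<lparr>carrier = amalg_words M1 M2 // amalg_cong M1 M2 N i1 i2,
     mult = (\<lambda>A B. \<Union>u \<in> A. \<Union>v \<in> B. amalg_class M1 M2 N i1 i2 (u @ v)),
     one = amalg_class M1 M2 N i1 i2 [Inl \<one>\<^bsub>M1\<^esub>]\<rparr>"

definition amalg_j1 ::
  "('a, 'x) monoid_scheme \<Rightarrow> ('b, 'y) monoid_scheme \<Rightarrow> ('c, 'z) monoid_scheme \<Rightarrow>
   ('c \<Rightarrow> 'a) \<Rightarrow> ('c \<Rightarrow> 'b) \<Rightarrow> 'a \<Rightarrow> ('a + 'b) list set" where
  "amalg_j1 M1 M2 N i1 i2 a = amalg_class M1 M2 N i1 i2 [Inl a]"

definition amalg_j2 ::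
  "('a, 'x) monoid_scheme \<Rightarrow> ('b, 'y) monoid_scheme \<Rightarrow> ('c, 'z) monoid_scheme \<Rightarrow>
   ('c \<Rightarrow> 'a) \<Rightarrow> ('c \<Rightarrow> 'b) \<Rightarrow> 'b \<Rightarrow> ('a + 'b) list set" where
  "amalg_j2 M1 M2 N i1 i2 b = amalg_class M1 M2 N i1 i2 [Inr b]"

(* The remaining facts show that amalg is a monoid and that the canonical maps are morphisms
   of monoids agreeing on N; neither injectivity nor specialness is needed for this. *)

locale amalg_data =
  fixes M1 :: "('a, 'x) monoid_scheme" and M2 :: "('b, 'y) monoid_scheme"
    and N :: "('c, 'z) monoid_scheme" and i1 :: "'c \<Rightarrow> 'a" and i2 :: "'c \<Rightarrow> 'b"
  assumes M1: "monoid M1" and M2: "monoid M2" and N: "monoid N"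
    and i1: "i1 \<in> monoid_hom N M1" and i2: "i2 \<in> monoid_hom N M2"
begin

lemma i1_closed: "n \<in> carrier N \<Longrightarrow> i1 n \<in> carrier M1"
  and i2_closed: "n \<in> carrier N \<Longrightarrow> i2 n \<in> carrier M2"
  and i1_one: "i1 \<one>\<^bsub>N\<^esub> = \<one>\<^bsub>M1\<^esub>" and i2_one: "i2 \<one>\<^bsub>N\<^esub> = \<one>\<^bsub>M2\<^esub>"
  using i1 i2 by (auto simp: monoid_hom_def hom_def)

lemma red_closed:
  "amalg_red M1 M2 N i1 i2 x y z \<Longrightarrow> {x, y, z} \<subseteq> carrier M1 <+> carrier M2"
  by (induction rule: amalg_red.induct)
    (auto simp: i1_closed i2_closed monoid.m_closed[OF M1] monoid.m_closed[OF M2])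

lemma cong_closed:
  "(w, w') \<in> amalg_cong M1 M2 N i1 i2 \<Longrightarrow> w \<in> amalg_words M1 M2 \<and> w' \<in> amalg_words M1 M2"
proof (induction rule: amalg_cong.induct)
  case (red u v x y z)
  with red_closed[OF red(3)] show ?case by (auto simp: amalg_words_def)
qed (auto simp: amalg_words_def)

lemma equiv_cong: "equiv (amalg_words M1 M2) (amalg_cong M1 M2 N i1 i2)"
proof (rule equivI)
  show "amalg_cong M1 M2 N i1 i2 \<subseteq> amalg_words M1 M2 \<times> amalg_words M1 M2"
    using cong_closed by auto
  show "refl_on (amalg_words M1 M2) (amalg_cong M1 M2 N i1 i2)"
    by (rule refl_onI) (rule amalg_cong.refl)
  show "sym (amalg_cong M1 M2 N i1 i2)"
    by (rule symI) (rule amalg_cong.sym)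
  show "trans (amalg_cong M1 M2 N i1 i2)"
    by (rule transI) (rule amalg_cong.trans)
qed

lemma class_eq_iff:
  assumes "w \<in> amalg_words M1 M2" "w' \<in> amalg_words M1 M2"
  shows "amalg_class M1 M2 N i1 i2 w = amalg_class M1 M2 N i1 i2 w' \<longleftrightarrow>
    (w, w') \<in> amalg_cong M1 M2 N i1 i2"
  unfolding amalg_class_def using eq_equiv_class_iff[OF equiv_cong assms] .

lemma class_eqI:
  "(w, w') \<in> amalg_cong M1 M2 N i1 i2 \<Longrightarrow>
    amalg_class M1 M2 N i1 i2 w = amalg_class M1 M2 N i1 i2 w'"
  unfolding amalg_class_def by (rule equiv_class_eq[OF equiv_cong])

lemma carrier_amalg:
  "carrier (amalg M1 M2 N i1 i2) = amalg_class M1 M2 N i1 i2 ` amalg_words M1 M2"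
  by (auto simp: amalg_def quotient_def amalg_class_def)

lemma mult_class:
  assumes "u \<in> amalg_words M1 M2" "v \<in> amalg_words M1 M2"
  shows "amalg_class M1 M2 N i1 i2 u \<otimes>\<^bsub>amalg M1 M2 N i1 i2\<^esub> amalg_class M1 M2 N i1 i2 v
    = amalg_class M1 M2 N i1 i2 (u @ v)"
proof -
  have eq: "amalg_class M1 M2 N i1 i2 (u' @ v') = amalg_class M1 M2 N i1 i2 (u @ v)"
    if "u' \<in> amalg_class M1 M2 N i1 i2 u" "v' \<in> amalg_class M1 M2 N i1 i2 v" for u' v'
    using that class_eqI[OF amalg_cong.append, of u u' v v'] by (auto simp: amalg_class_def)
  have "u \<in> amalg_class M1 M2 N i1 i2 u" "v \<in> amalg_class M1 M2 N i1 i2 v"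
    using assms by (auto simp: amalg_class_def intro: amalg_cong.refl)
  with eq show ?thesis
    unfolding amalg_def monoid.simps by blast
qed

lemma class_red:
  assumes "amalg_red M1 M2 N i1 i2 x y z"
    "u \<in> lists (carrier M1 <+> carrier M2)" "v \<in> lists (carrier M1 <+> carrier M2)"
  shows "amalg_class M1 M2 N i1 i2 (u @ x # y # v) = amalg_class M1 M2 N i1 i2 (u @ z # v)"
  using class_eqI[OF amalg_cong.red[OF assms(2,3,1)]] by simp

lemma amalg_j_agree:
  assumes n: "n \<in> carrier N"
  shows "amalg_j1 M1 M2 N i1 i2 (i1 n) = amalg_j2 M1 M2 N i1 i2 (i2 n)"
proof -
  have "amalg_class M1 M2 N i1 i2 [Inl \<one>\<^bsub>M1\<^esub>, Inr (i2 n)] = amalg_class M1 M2 N i1 i2 [Inl (i1 n)]"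
    using class_red[OF amalg_red.right1[OF monoid.one_closed[OF M1] n], of "[]" "[]"] n
    by (simp add: monoid.l_one[OF M1] i1_closed)
  moreover
  have "amalg_class M1 M2 N i1 i2 [Inl \<one>\<^bsub>M1\<^esub>, Inr (i2 n)] = amalg_class M1 M2 N i1 i2 [Inr (i2 n)]"
    using class_red[OF amalg_red.left1[OF monoid.one_closed[OF N] i2_closed[OF n]], of "[]" "[]"] n
    by (simp add: monoid.l_one[OF M2] i2_closed i1_one i2_one)
  ultimately show ?thesis by (simp add: amalg_j1_def amalg_j2_def)
qed

lemma amalg_one_eq:
  "\<one>\<^bsub>amalg M1 M2 N i1 i2\<^esub> = amalg_class M1 M2 N i1 i2 [Inl \<one>\<^bsub>M1\<^esub>]"
  "\<one>\<^bsub>amalg M1 M2 N i1 i2\<^esub> = amalg_class M1 M2 N i1 i2 [Inr \<one>\<^bsub>M2\<^esub>]"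
  using amalg_j_agree[OF monoid.one_closed[OF N]]
  by (simp_all add: amalg_def amalg_j1_def amalg_j2_def i1_one i2_one)

lemma class_one_left:
  assumes w: "w \<in> amalg_words M1 M2"
  shows "amalg_class M1 M2 N i1 i2 ([Inl \<one>\<^bsub>M1\<^esub>] @ w) = amalg_class M1 M2 N i1 i2 w"
proof -
  obtain x v where xv: "w = x # v" "v \<in> lists (carrier M1 <+> carrier M2)"
    "x \<in> carrier M1 <+> carrier M2"
    using w by (cases w) (auto simp: amalg_words_def)
  have "amalg_red M1 M2 N i1 i2 (Inl \<one>\<^bsub>M1\<^esub>) x x"
  proof (cases x)
    case (Inl a)
    with xv amalg_red.same1[of "\<one>\<^bsub>M1\<^esub>" M1 a] M1 show ?thesis
      by (auto simp: monoid.one_closed monoid.l_one)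
  next
    case (Inr b)
    with xv amalg_red.left1[OF monoid.one_closed[OF N], of b M2 M1 i1 i2] M2 show ?thesis
      by (auto simp: i1_one i2_one monoid.l_one)
  qed
  from class_red[OF this _ xv(2), of "[]"] xv(1) show ?thesis by simp
qed

lemma class_one_right:
  assumes w: "w \<in> amalg_words M1 M2"
  shows "amalg_class M1 M2 N i1 i2 (w @ [Inl \<one>\<^bsub>M1\<^esub>]) = amalg_class M1 M2 N i1 i2 w"
proof -
  obtain x v where xv: "w = v @ [x]" "v \<in> lists (carrier M1 <+> carrier M2)"
    "x \<in> carrier M1 <+> carrier M2"
    using w by (cases w rule: rev_cases) (auto simp: amalg_words_def)
  have "amalg_red M1 M2 N i1 i2 x (Inl \<one>\<^bsub>M1\<^esub>) x"
  proof (cases x)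
    case (Inl a)
    with xv amalg_red.same1[of a M1 "\<one>\<^bsub>M1\<^esub>"] M1 show ?thesis
      by (auto simp: monoid.one_closed monoid.r_one)
  next
    case (Inr b)
    with xv amalg_red.right2[of b M2 "\<one>\<^bsub>N\<^esub>" N M1 i1 i2] M2 N show ?thesis
      by (auto simp: i1_one i2_one monoid.r_one monoid.one_closed)
  qed
  from class_red[OF this xv(2), of "[]"] xv(1) show ?thesis by simp
qed

lemma one_words: "[Inl \<one>\<^bsub>M1\<^esub>] \<in> amalg_words M1 M2" "[Inr \<one>\<^bsub>M2\<^esub>] \<in> amalg_words M1 M2"
  using M1 M2 by (auto simp: amalg_words_def monoid.one_closed)

lemma append_words:
  "u \<in> amalg_words M1 M2 \<Longrightarrow> v \<in> amalg_words M1 M2 \<Longrightarrow> u @ v \<in> amalg_words M1 M2"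
  by (auto simp: amalg_words_def)

lemma class_in_carrier:
  "w \<in> amalg_words M1 M2 \<Longrightarrow> amalg_class M1 M2 N i1 i2 w \<in> carrier (amalg M1 M2 N i1 i2)"
  unfolding carrier_amalg by (rule imageI)

lemma monoid_amalg: "monoid (amalg M1 M2 N i1 i2)"
proof (rule monoidI)
  let ?P = "amalg M1 M2 N i1 i2" and ?c = "amalg_class M1 M2 N i1 i2"
  show "\<one>\<^bsub>?P\<^esub> \<in> carrier ?P"
    unfolding amalg_one_eq(1) by (rule class_in_carrier[OF one_words(1)])
  fix A assume "A \<in> carrier ?P"
  then obtain u where u: "u \<in> amalg_words M1 M2" "A = ?c u"
    unfolding carrier_amalg by (rule imageE)
  show "\<one>\<^bsub>?P\<^esub> \<otimes>\<^bsub>?P\<^esub> A = A"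
    unfolding amalg_one_eq(1) u(2) mult_class[OF one_words(1) u(1)] by (rule class_one_left[OF u(1)])
  show "A \<otimes>\<^bsub>?P\<^esub> \<one>\<^bsub>?P\<^esub> = A"
    unfolding amalg_one_eq(1) u(2) mult_class[OF u(1) one_words(1)] by (rule class_one_right[OF u(1)])
  fix B assume "B \<in> carrier ?P"
  then obtain v where v: "v \<in> amalg_words M1 M2" "B = ?c v"
    unfolding carrier_amalg by (rule imageE)
  show "A \<otimes>\<^bsub>?P\<^esub> B \<in> carrier ?P"
    unfolding u(2) v(2) mult_class[OF u(1) v(1)]
    by (rule class_in_carrier[OF append_words[OF u(1) v(1)]])
  fix C assume "C \<in> carrier ?P"
  then obtain w where w: "w \<in> amalg_words M1 M2" "C = ?c w"
    unfolding carrier_amalg by (rule imageE)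
  show "A \<otimes>\<^bsub>?P\<^esub> B \<otimes>\<^bsub>?P\<^esub> C = A \<otimes>\<^bsub>?P\<^esub> (B \<otimes>\<^bsub>?P\<^esub> C)"
    using u v w by (simp add: mult_class append_words)
qed

lemma amalg_j1_hom: "amalg_j1 M1 M2 N i1 i2 \<in> monoid_hom M1 (amalg M1 M2 N i1 i2)"
proof -
  let ?P = "amalg M1 M2 N i1 i2" and ?j = "amalg_j1 M1 M2 N i1 i2"
  have w: "[Inl a] \<in> amalg_words M1 M2" if "a \<in> carrier M1" for a
    using that by (auto simp: amalg_words_def)
  have "?j a \<in> carrier ?P" if "a \<in> carrier M1" for a
    unfolding amalg_j1_def by (rule class_in_carrier[OF w[OF that]])
  moreover have "?j (a \<otimes>\<^bsub>M1\<^esub> b) = ?j a \<otimes>\<^bsub>?P\<^esub> ?j b"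
    if "a \<in> carrier M1" "b \<in> carrier M1" for a b
    using class_red[OF amalg_red.same1[OF that], of "[]" "[]"]
    unfolding amalg_j1_def mult_class[OF w[OF that(1)] w[OF that(2)]] by simp
  moreover have "?j \<one>\<^bsub>M1\<^esub> = \<one>\<^bsub>?P\<^esub>"
    unfolding amalg_j1_def by (rule amalg_one_eq(1)[symmetric])
  ultimately show ?thesis by (simp add: monoid_hom_def hom_def)
qed

lemma amalg_j2_hom: "amalg_j2 M1 M2 N i1 i2 \<in> monoid_hom M2 (amalg M1 M2 N i1 i2)"
proof -
  let ?P = "amalg M1 M2 N i1 i2" and ?j = "amalg_j2 M1 M2 N i1 i2"
  have w: "[Inr a] \<in> amalg_words M1 M2" if "a \<in> carrier M2" for a
    using that by (auto simp: amalg_words_def)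
  have "?j a \<in> carrier ?P" if "a \<in> carrier M2" for a
    unfolding amalg_j2_def by (rule class_in_carrier[OF w[OF that]])
  moreover have "?j (a \<otimes>\<^bsub>M2\<^esub> b) = ?j a \<otimes>\<^bsub>?P\<^esub> ?j b"
    if "a \<in> carrier M2" "b \<in> carrier M2" for a b
    using class_red[OF amalg_red.same2[OF that], of "[]" "[]"]
    unfolding amalg_j2_def mult_class[OF w[OF that(1)] w[OF that(2)]] by simp
  moreover have "?j \<one>\<^bsub>M2\<^esub> = \<one>\<^bsub>?P\<^esub>"
    unfolding amalg_j2_def by (rule amalg_one_eq(2)[symmetric])
  ultimately show ?thesis by (simp add: monoid_hom_def hom_def)
qed

end

end

theory Submission
  imports Defs
begin

text \<open>
  Adjoin a zero \<open>0\<close> to \<open>M\<^sub>1\<close>. Specialness of \<open>\<iota>\<^sub>2(N)\<close> says exactly that a product in \<open>M\<^sub>2\<close> lies in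
  \<open>\<iota>\<^sub>2(N)\<close> if and only if both factors do. Hence the map \<open>M\<^sub>2 \<rightarrow> M\<^sub>1 \<union> {0}\<close> that is
  \<open>\<iota>\<^sub>1 \<circ> \<iota>\<^sub>2\<^sup>-\<^sup>1\<close> on \<open>\<iota>\<^sub>2(N)\<close> and \<open>0\<close> elsewhere is multiplicative (\<open>collapse_hom\<close>), and it agrees with
  the inclusion \<open>M\<^sub>1 \<rightarrow> M\<^sub>1 \<union> {0}\<close> on \<open>N\<close>. The universal property of the amalgamated product
  (\<open>amalg_universal\<close>) yields a multiplicative \<open>\<phi>\<^sub>1\<close> from \<open>M\<^sub>1 *\<^sub>N M\<^sub>2\<close> to \<open>M\<^sub>1 \<union> {0}\<close>
  with \<open>\<phi>\<^sub>1(j\<^sub>1(a)) = a\<close>.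

  This retraction carries everything (\<open>special_image_of_retraction\<close>). It makes \<open>j\<^sub>1\<close> injective. A
  product with nonzero value has all its entries in \<open>M\<^sub>1\<close> or in \<open>\<iota>\<^sub>2(N)\<close>, so \<open>j\<^sub>1(M\<^sub>1)\<close> is exactly the
  set of elements on which \<open>\<phi>\<^sub>1\<close> is nonzero, and this set is closed under factors because \<open>0\<close> is
  absorbing. The same holds for \<open>M\<^sub>2\<close> by symmetry. If \<open>j\<^sub>1(a) = j\<^sub>2(b)\<close>, then \<open>\<phi>\<^sub>1(j\<^sub>2(b)) = a\<close> is
  nonzero, so that \<open>b \<in> \<iota>\<^sub>2(N)\<close>; this computes the intersection, which is special because an
  intersection of special submonoids is special.
\<close>

section \<open>Special submonoids and monoids with a zero adjoined\<close>

definition adjoin_zero :: "('a, 'x) monoid_scheme \<Rightarrow> 'a option monoid" where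
  "adjoin_zero M =
    \<lparr>carrier = insert None (Some ` carrier M),
     mult = (\<lambda>x y. case (x, y) of (Some a, Some b) \<Rightarrow> Some (a \<otimes>\<^bsub>M\<^esub> b) | _ \<Rightarrow> None),
     one = Some \<one>\<^bsub>M\<^esub>\<rparr>"

lemma adjoin_zero_simps [simp]:
  "carrier (adjoin_zero M) = insert None (Some ` carrier M)"
  "Some a \<otimes>\<^bsub>adjoin_zero M\<^esub> Some b = Some (a \<otimes>\<^bsub>M\<^esub> b)"
  "x \<otimes>\<^bsub>adjoin_zero M\<^esub> None = None"
  "None \<otimes>\<^bsub>adjoin_zero M\<^esub> x = None"
  "\<one>\<^bsub>adjoin_zero M\<^esub> = Some \<one>\<^bsub>M\<^esub>"
  by (auto simp: adjoin_zero_def split: option.splits)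

lemma adjoin_zero_mult_nonzero:
  "x \<otimes>\<^bsub>adjoin_zero M\<^esub> y \<noteq> None \<Longrightarrow> x \<noteq> None \<and> y \<noteq> None"
  by (cases x; cases y) simp_all

lemma monoid_adjoin_zero:
  assumes "monoid M"
  shows "monoid (adjoin_zero M)"
  by (rule monoidI)
    (auto simp: monoid.m_closed[OF assms] monoid.one_closed[OF assms] monoid.m_assoc[OF assms]
      monoid.l_one[OF assms] monoid.r_one[OF assms])

lemma Some_hom_adjoin_zero: "Some \<in> hom M (adjoin_zero M)"
  by (auto simp: hom_def)

lemma special_submonoid_Int:
  assumes "special_submonoid A M" "special_submonoid B M"
  shows "special_submonoid (A \<inter> B) M"
proof -
  have "submonoid (A \<inter> B) M"
    using assms unfolding special_submonoid_def
    by (intro submonoid.intro) (auto dest: submonoid.subset submonoid.m_closed submonoid.one_closed)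
  with assms show ?thesis
    unfolding special_submonoid_def by blast
qed

lemma submonoid_hom_image:
  assumes M: "monoid M" and j: "j \<in> monoid_hom M P"
  shows "submonoid (j ` carrier M) P"
proof
  have mult: "j (a \<otimes>\<^bsub>M\<^esub> b) = j a \<otimes>\<^bsub>P\<^esub> j b" if "a \<in> carrier M" "b \<in> carrier M" for a b
    using j that by (auto simp: monoid_hom_def hom_def)
  show "j ` carrier M \<subseteq> carrier P"
    using j by (auto simp: monoid_hom_def hom_def)
  show "x \<otimes>\<^bsub>P\<^esub> y \<in> j ` carrier M" if "x \<in> j ` carrier M" "y \<in> j ` carrier M" for x y
    using that by (auto simp: mult[symmetric] monoid.m_closed[OF M])
  show "\<one>\<^bsub>P\<^esub> \<in> j ` carrier M"
    using j monoid.one_closed[OF M] by (force simp: monoid_hom_def)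
qed

text \<open>Together, \<open>retr\<close> and \<open>img\<close> identify \<open>j(M)\<close> with the complement of \<open>\<phi>\<^sup>-\<^sup>1(0)\<close>; as \<open>\<phi>\<^sup>-\<^sup>1(0)\<close> is an
  ideal, its complement contains all factors of its elements.\<close>

lemma special_image_of_retraction:
  assumes M: "monoid M" and j: "j \<in> monoid_hom M P" and \<phi>: "\<phi> \<in> hom P (adjoin_zero M)"
    and retr: "\<And>a. a \<in> carrier M \<Longrightarrow> \<phi> (j a) = Some a"
    and img: "\<And>x. x \<in> carrier P \<Longrightarrow> \<phi> x \<noteq> None \<Longrightarrow> x \<in> j ` carrier M"
  shows "inj_on j (carrier M)" "special_submonoid (j ` carrier M) P"
proof -
  show "inj_on j (carrier M)"
    by (rule inj_onI) (metis retr option.inject)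
  have "x \<in> j ` carrier M \<and> y \<in> j ` carrier M"
    if xy: "x \<in> carrier P" "y \<in> carrier P" "x \<otimes>\<^bsub>P\<^esub> y \<in> j ` carrier M" for x y
  proof -
    have "\<phi> x \<otimes>\<^bsub>adjoin_zero M\<^esub> \<phi> y = \<phi> (x \<otimes>\<^bsub>P\<^esub> y)"
      using \<phi> xy by (simp add: hom_mult)
    also have "\<dots> \<noteq> None"
      using xy(3) retr by auto
    finally have "\<phi> x \<noteq> None \<and> \<phi> y \<noteq> None"
      by (rule adjoin_zero_mult_nonzero)
    with img xy show ?thesis by blast
  qed
  with submonoid_hom_image[OF M j] show "special_submonoid (j ` carrier M) P"
    by (simp add: special_submonoid_def)
qed

text \<open>The partial map \<open>k \<circ> i\<^sup>-\<^sup>1\<close>, made total by the value zero outside the image of \<open>i\<close>.\<close>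

definition collapse ::
  "('c, 'z) monoid_scheme \<Rightarrow> ('c \<Rightarrow> 'b) \<Rightarrow> ('c \<Rightarrow> 'a) \<Rightarrow> 'b \<Rightarrow> 'a option" where
  "collapse N i k b =
    (if b \<in> i ` carrier N then Some (k (inv_into (carrier N) i b)) else None)"

lemma collapse_image:
  assumes "inj_on i (carrier N)" "n \<in> carrier N"
  shows "collapse N i k (i n) = Some (k n)"
  using assms by (simp add: collapse_def)

text \<open>Multiplicativity is where specialness enters: a product with a factor outside \<open>i(N)\<close> must be
  outside \<open>i(N)\<close> itself, so that both sides are zero.\<close>

lemma collapse_hom:
  assumes N: "monoid N" and i: "i \<in> hom N M" "inj_on i (carrier N)" and k: "k \<in> hom N M'"
    and special: "special_submonoid (i ` carrier N) M"
  shows "collapse N i k \<in> hom M (adjoin_zero M')"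
proof (rule homI)
  fix b assume "b \<in> carrier M"
  show "collapse N i k b \<in> carrier (adjoin_zero M')"
    using hom_in_carrier[OF k] by (auto simp: collapse_def i(2))
next
  fix b b' assume b: "b \<in> carrier M" "b' \<in> carrier M"
  show "collapse N i k (b \<otimes>\<^bsub>M\<^esub> b') = collapse N i k b \<otimes>\<^bsub>adjoin_zero M'\<^esub> collapse N i k b'"
  proof (cases "b \<in> i ` carrier N \<and> b' \<in> i ` carrier N")
    case True
    then obtain n n' where n: "n \<in> carrier N" "n' \<in> carrier N" "b = i n" "b' = i n'"
      by blast
    then have "b \<otimes>\<^bsub>M\<^esub> b' = i (n \<otimes>\<^bsub>N\<^esub> n')" "k (n \<otimes>\<^bsub>N\<^esub> n') = k n \<otimes>\<^bsub>M'\<^esub> k n'"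
      by (simp_all add: hom_mult[OF i(1)] hom_mult[OF k])
    with n show ?thesis
      by (simp add: collapse_image[OF i(2)] monoid.m_closed[OF N])
  next
    case False
    with special b have "b \<otimes>\<^bsub>M\<^esub> b' \<notin> i ` carrier N"
      by (auto simp: special_submonoid_def)
    with False show ?thesis by (auto simp: collapse_def)
  qed
qed

section \<open>The universal property of the amalgamated product\<close>

definition word_value ::
  "('q, 'w) monoid_scheme \<Rightarrow> ('a \<Rightarrow> 'q) \<Rightarrow> ('b \<Rightarrow> 'q) \<Rightarrow> ('a + 'b) list \<Rightarrow> 'q" where
  "word_value Q f g w = foldr (\<lambda>x q. case_sum f g x \<otimes>\<^bsub>Q\<^esub> q) w \<one>\<^bsub>Q\<^esub>"

lemma word_value_simps [simp]:
  "word_value Q f g [] = \<one>\<^bsub>Q\<^esub>"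
  "word_value Q f g (x # w) = case_sum f g x \<otimes>\<^bsub>Q\<^esub> word_value Q f g w"
  by (simp_all add: word_value_def)

context amalg_data
begin

abbreviation "letters \<equiv> carrier M1 <+> carrier M2"
abbreviation "P \<equiv> amalg M1 M2 N i1 i2"
abbreviation "cls \<equiv> amalg_class M1 M2 N i1 i2"
abbreviation "j1 \<equiv> amalg_j1 M1 M2 N i1 i2"
abbreviation "j2 \<equiv> amalg_j2 M1 M2 N i1 i2"

lemma word_value_closed:
  assumes Q: "monoid Q" and f: "f \<in> hom M1 Q" and g: "g \<in> hom M2 Q"
    and w: "w \<in> lists letters"
  shows "word_value Q f g w \<in> carrier Q"
  using w by induction
    (auto simp: monoid.one_closed[OF Q] hom_in_carrier[OF f] hom_in_carrier[OF g]
      intro!: monoid.m_closed[OF Q])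

lemma word_value_append:
  assumes Q: "monoid Q" and f: "f \<in> hom M1 Q" and g: "g \<in> hom M2 Q"
    and u: "u \<in> lists letters" and v: "v \<in> lists letters"
  shows "word_value Q f g (u @ v) = word_value Q f g u \<otimes>\<^bsub>Q\<^esub> word_value Q f g v"
  using u
proof induction
  case Nil
  show ?case by (simp add: monoid.l_one[OF Q] word_value_closed[OF Q f g v])
next
  case (Cons x u)
  then have "case_sum f g x \<in> carrier Q"
    by (auto simp: hom_in_carrier[OF f] hom_in_carrier[OF g])
  with Cons show ?case
    by (simp add: monoid.m_assoc[OF Q] word_value_closed[OF Q f g] v)
qed

lemma word_value_cong:
  assumes Q: "monoid Q" and f: "f \<in> hom M1 Q" and g: "g \<in> hom M2 Q"
    and agree: "\<And>n. n \<in> carrier N \<Longrightarrow> f (i1 n) = g (i2 n)"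
    and w: "(w, w') \<in> amalg_cong M1 M2 N i1 i2"
  shows "word_value Q f g w = word_value Q f g w'"
  using w
proof induction
  case (red u v x y z)
  note closed = red_closed[OF red(3)]
  have "case_sum f g z = case_sum f g x \<otimes>\<^bsub>Q\<^esub> case_sum f g y"
    using red(3) by cases
      (auto simp: hom_mult[OF f] hom_mult[OF g] i1_closed i2_closed agree)
  moreover have "case_sum f g x \<in> carrier Q" "case_sum f g y \<in> carrier Q"
    using closed by (auto simp: hom_in_carrier[OF f] hom_in_carrier[OF g])
  ultimately have "word_value Q f g [x, y] = word_value Q f g [z]"
    by (simp add: monoid.m_assoc[OF Q] monoid.one_closed[OF Q])
  moreover have "[x, y] \<in> lists letters" "[z] \<in> lists letters"
    using closed by auto
  ultimately show ?case
    using red(1,2) by (simp only: word_value_append[OF Q f g] append_in_lists_conv)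
next
  case (append u u' v v')
  then show ?case
    using cong_closed by (simp add: word_value_append[OF Q f g] amalg_words_def)
qed auto

text \<open>On a class, \<open>\<phi>\<close> is the value of any representative word, by \<open>word_value_cong\<close>.\<close>

lemma amalg_universal:
  assumes Q: "monoid Q" and f: "f \<in> hom M1 Q" and g: "g \<in> hom M2 Q"
    and agree: "\<And>n. n \<in> carrier N \<Longrightarrow> f (i1 n) = g (i2 n)"
  obtains \<phi> where "\<phi> \<in> hom P Q"
    "\<And>a. a \<in> carrier M1 \<Longrightarrow> \<phi> (j1 a) = f a" "\<And>b. b \<in> carrier M2 \<Longrightarrow> \<phi> (j2 b) = g b"
proof -
  define \<phi> where "\<phi> A = word_value Q f g (SOME w. w \<in> A)" for A
  have \<phi>: "\<phi> (cls w) = word_value Q f g w" if w: "w \<in> amalg_words M1 M2" for w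
  proof -
    have "w \<in> cls w"
      using w by (auto simp: amalg_class_def intro: amalg_cong.refl)
    then have "(SOME w'. w' \<in> cls w) \<in> cls w"
      by (rule someI)
    then show ?thesis
      using word_value_cong[OF Q f g agree] by (simp add: amalg_class_def \<phi>_def)
  qed
  have words: "w \<in> lists letters" if "w \<in> amalg_words M1 M2" for w
    using that by (simp add: amalg_words_def)
  show thesis
  proof (rule that)
    show "\<phi> \<in> hom P Q"
    proof (rule homI)
      fix A assume "A \<in> carrier P"
      then show "\<phi> A \<in> carrier Q"
        by (auto simp: carrier_amalg \<phi> words word_value_closed[OF Q f g])
    next
      fix A B assume "A \<in> carrier P" "B \<in> carrier P"
      then show "\<phi> (A \<otimes>\<^bsub>P\<^esub> B) = \<phi> A \<otimes>\<^bsub>Q\<^esub> \<phi> B"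
        by (auto simp: carrier_amalg mult_class \<phi> append_words words word_value_append[OF Q f g])
    qed
    show "\<phi> (j1 a) = f a" if "a \<in> carrier M1" for a
      using that
      by (simp add: amalg_j1_def \<phi> amalg_words_def InlI monoid.r_one[OF Q] hom_in_carrier[OF f])
    show "\<phi> (j2 b) = g b" if "b \<in> carrier M2" for b
      using that
      by (simp add: amalg_j2_def \<phi> amalg_words_def InrI monoid.r_one[OF Q] hom_in_carrier[OF g])
  qed
qed

lemma amalg_induct [consumes 1, case_names j1 j2 mult]:
  assumes A: "A \<in> carrier P"
    and j1: "\<And>a. a \<in> carrier M1 \<Longrightarrow> R (j1 a)" and j2: "\<And>b. b \<in> carrier M2 \<Longrightarrow> R (j2 b)"
    and mult: "\<And>A B. A \<in> carrier P \<Longrightarrow> B \<in> carrier P \<Longrightarrow> R A \<Longrightarrow> R B \<Longrightarrow> R (A \<otimes>\<^bsub>P\<^esub> B)"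
  shows "R A"
proof -
  obtain w where w: "w \<noteq> []" "w \<in> lists letters" "A = cls w"
    using A by (auto simp: carrier_amalg amalg_words_def)
  from w(1,2) have "R (cls w)"
  proof (induction w rule: list_nonempty_induct)
    case (single x)
    with j1 j2 show ?case by (auto simp: amalg_j1_def amalg_j2_def)
  next
    case (cons x w)
    then have x: "[x] \<in> amalg_words M1 M2" and w: "w \<in> amalg_words M1 M2"
      by (auto simp: amalg_words_def)
    have "R (cls [x])"
      using cons j1 j2 by (auto simp: amalg_j1_def amalg_j2_def)
    with mult[OF class_in_carrier[OF x] class_in_carrier[OF w]] cons show ?case
      by (simp add: mult_class[OF x w])
  qed
  with w show ?thesis by simp
qed

section \<open>The retractions onto the factors\<close>

text \<open>The zero set of \<open>\<phi>\<close> is controlled by induction over products of images of \<open>j\<^sub>1\<close> and \<open>j\<^sub>2\<close>: a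
  nonzero product has nonzero factors, and \<open>j\<^sub>2(b)\<close> has nonzero value only for \<open>b \<in> \<iota>\<^sub>2(N)\<close>, in which
  case \<open>j\<^sub>2(b)\<close> lies in \<open>j\<^sub>1(M\<^sub>1)\<close> as well. The third property is what determines
  \<open>j\<^sub>1(M\<^sub>1) \<inter> j\<^sub>2(M\<^sub>2)\<close>.\<close>

lemma retraction1:
  assumes inj2: "inj_on i2 (carrier N)" and special2: "special_submonoid (i2 ` carrier N) M2"
  obtains \<phi> where "\<phi> \<in> hom P (adjoin_zero M1)"
    "\<And>a. a \<in> carrier M1 \<Longrightarrow> \<phi> (j1 a) = Some a"
    "\<And>b. b \<in> carrier M2 \<Longrightarrow> \<phi> (j2 b) \<noteq> None \<Longrightarrow> b \<in> i2 ` carrier N"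
    "\<And>A. A \<in> carrier P \<Longrightarrow> \<phi> A \<noteq> None \<Longrightarrow> A \<in> j1 ` carrier M1"
proof -
  have "collapse N i2 i1 \<in> hom M2 (adjoin_zero M1)"
    using i1 i2 by (intro collapse_hom N inj2 special2) (simp_all add: monoid_hom_def)
  from amalg_universal[OF monoid_adjoin_zero[OF M1] Some_hom_adjoin_zero this]
  obtain \<phi> where \<phi>: "\<phi> \<in> hom P (adjoin_zero M1)"
      "\<And>a. a \<in> carrier M1 \<Longrightarrow> \<phi> (j1 a) = Some a"
      "\<And>b. b \<in> carrier M2 \<Longrightarrow> \<phi> (j2 b) = collapse N i2 i1 b"
    by (auto simp: collapse_image[OF inj2])
  have N: "b \<in> i2 ` carrier N" if "b \<in> carrier M2" "\<phi> (j2 b) \<noteq> None" for b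
    using that by (auto simp: \<phi>(3) collapse_def split: if_splits)
  have "\<phi> A \<noteq> None \<longrightarrow> A \<in> j1 ` carrier M1" if "A \<in> carrier P" for A
    using that
  proof (induction A rule: amalg_induct)
    case (j2 b)
    with N i1_closed show ?case by (force simp: amalg_j_agree[symmetric])
  next
    case (mult A B)
    show ?case
    proof
      assume "\<phi> (A \<otimes>\<^bsub>P\<^esub> B) \<noteq> None"
      then have "\<phi> A \<noteq> None \<and> \<phi> B \<noteq> None"
        unfolding hom_mult[OF \<phi>(1) mult(1,2)] by (rule adjoin_zero_mult_nonzero)
      with mult submonoid.m_closed[OF submonoid_hom_image[OF M1 amalg_j1_hom]]
      show "A \<otimes>\<^bsub>P\<^esub> B \<in> j1 ` carrier M1" by blast
    qed
  qed auto
  with that \<phi>(1,2) N show thesis by blast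
qed

lemma retraction2:
  assumes inj1: "inj_on i1 (carrier N)" and special1: "special_submonoid (i1 ` carrier N) M1"
  obtains \<phi> where "\<phi> \<in> hom P (adjoin_zero M2)"
    "\<And>b. b \<in> carrier M2 \<Longrightarrow> \<phi> (j2 b) = Some b"
    "\<And>A. A \<in> carrier P \<Longrightarrow> \<phi> A \<noteq> None \<Longrightarrow> A \<in> j2 ` carrier M2"
proof -
  have "collapse N i1 i2 \<in> hom M1 (adjoin_zero M2)"
    using i1 i2 by (intro collapse_hom N inj1 special1) (simp_all add: monoid_hom_def)
  from amalg_universal[OF monoid_adjoin_zero[OF M2] this Some_hom_adjoin_zero]
  obtain \<phi> where \<phi>: "\<phi> \<in> hom P (adjoin_zero M2)"
      "\<And>a. a \<in> carrier M1 \<Longrightarrow> \<phi> (j1 a) = collapse N i1 i2 a"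
      "\<And>b. b \<in> carrier M2 \<Longrightarrow> \<phi> (j2 b) = Some b"
    by (auto simp: collapse_image[OF inj1])
  have "\<phi> A \<noteq> None \<longrightarrow> A \<in> j2 ` carrier M2" if "A \<in> carrier P" for A
    using that
  proof (induction A rule: amalg_induct)
    case (j1 a)
    show ?case
    proof
      assume "\<phi> (j1 a) \<noteq> None"
      with j1 have "a \<in> i1 ` carrier N"
        by (auto simp: \<phi>(2) collapse_def split: if_splits)
      with i2_closed show "amalg_j1 M1 M2 N i1 i2 a \<in> j2 ` carrier M2"
        by (force simp: amalg_j_agree)
    qed
  next
    case (mult A B)
    show ?case
    proof
      assume "\<phi> (A \<otimes>\<^bsub>P\<^esub> B) \<noteq> None"
      then have "\<phi> A \<noteq> None \<and> \<phi> B \<noteq> None"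
        unfolding hom_mult[OF \<phi>(1) mult(1,2)] by (rule adjoin_zero_mult_nonzero)
      with mult submonoid.m_closed[OF submonoid_hom_image[OF M2 amalg_j2_hom]]
      show "A \<otimes>\<^bsub>P\<^esub> B \<in> j2 ` carrier M2" by blast
    qed
  qed auto
  with that \<phi>(1,3) show thesis by blast
qed

end

theorem proposition3p1:
  fixes M1 :: "('a, 'x) monoid_scheme" and M2 :: "('b, 'y) monoid_scheme"
    and N :: "('c, 'z) monoid_scheme" and i1 :: "'c \<Rightarrow> 'a" and i2 :: "'c \<Rightarrow> 'b"
  assumes "monoid M1" and "monoid M2" and "monoid N"
    and "i1 \<in> monoid_hom N M1" and "inj_on i1 (carrier N)"
    and "i2 \<in> monoid_hom N M2" and "inj_on i2 (carrier N)"
    and "special_submonoid (i1 ` carrier N) M1"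
    and "special_submonoid (i2 ` carrier N) M2"
  defines "P \<equiv> amalg M1 M2 N i1 i2"
    and "j1 \<equiv> amalg_j1 M1 M2 N i1 i2"
    and "j2 \<equiv> amalg_j2 M1 M2 N i1 i2"
  shows "inj_on j1 (carrier M1) \<and> inj_on j2 (carrier M2)
    \<and> special_submonoid (j1 ` carrier M1) P
    \<and> special_submonoid (j2 ` carrier M2) P
    \<and> special_submonoid ((j1 \<circ> i1) ` carrier N) P
    \<and> j1 ` carrier M1 \<inter> j2 ` carrier M2 = (j1 \<circ> i1) ` carrier N
    \<and> (j1 \<circ> i1) ` carrier N = (j2 \<circ> i2) ` carrier N"
proof -
  interpret D: amalg_data M1 M2 N i1 i2
    using assms(1-4,6) by (intro amalg_data.intro)
  note P = P_def j1_def j2_def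
  obtain \<phi> where \<phi>: "\<phi> \<in> hom P (adjoin_zero M1)"
      "\<And>a. a \<in> carrier M1 \<Longrightarrow> \<phi> (j1 a) = Some a"
      "\<And>b. b \<in> carrier M2 \<Longrightarrow> \<phi> (j2 b) \<noteq> None \<Longrightarrow> b \<in> i2 ` carrier N"
      "\<And>A. A \<in> carrier P \<Longrightarrow> \<phi> A \<noteq> None \<Longrightarrow> A \<in> j1 ` carrier M1"
    using D.retraction1[OF assms(7,9)] unfolding P by metis
  obtain \<psi> where \<psi>: "\<psi> \<in> hom P (adjoin_zero M2)"
      "\<And>b. b \<in> carrier M2 \<Longrightarrow> \<psi> (j2 b) = Some b"
      "\<And>A. A \<in> carrier P \<Longrightarrow> \<psi> A \<noteq> None \<Longrightarrow> A \<in> j2 ` carrier M2"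
    using D.retraction2[OF assms(5,8)] unfolding P by metis
  have j1: "j1 \<in> monoid_hom M1 P" and j2: "j2 \<in> monoid_hom M2 P"
    unfolding P by (rule D.amalg_j1_hom D.amalg_j2_hom)+
  have agree: "j1 (i1 n) = j2 (i2 n)" if "n \<in> carrier N" for n
    unfolding P using that by (rule D.amalg_j_agree)
  note f1 = special_image_of_retraction[OF \<open>monoid M1\<close> j1 \<phi>(1,2,4)]
  note f2 = special_image_of_retraction[OF \<open>monoid M2\<close> j2 \<psi>]
  have N_eq: "(j1 \<circ> i1) ` carrier N = (j2 \<circ> i2) ` carrier N"
    using agree by (auto intro!: image_cong)
  have Int_eq: "j1 ` carrier M1 \<inter> j2 ` carrier M2 = (j1 \<circ> i1) ` carrier N"
  proof (intro equalityI subsetI)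
    fix x assume "x \<in> j1 ` carrier M1 \<inter> j2 ` carrier M2"
    then obtain a b where ab: "a \<in> carrier M1" "b \<in> carrier M2" "x = j1 a" "x = j2 b"
      by auto
    then have "\<phi> (j2 b) \<noteq> None"
      using \<phi>(2)[of a] by simp
    with ab \<phi>(3)[of b] have "x \<in> (j2 \<circ> i2) ` carrier N"
      by (metis image_comp image_eqI)
    with N_eq show "x \<in> (j1 \<circ> i1) ` carrier N" by simp
  next
    fix x assume "x \<in> (j1 \<circ> i1) ` carrier N"
    then show "x \<in> j1 ` carrier M1 \<inter> j2 ` carrier M2"
      using agree D.i1_closed D.i2_closed by auto
  qed
  from special_submonoid_Int[OF f1(2) f2(2)] f1 f2 N_eq Int_eq show ?thesis
    by simp
qed

end
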